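(* Let $Q$ be a commutative Noetherian monoid and $P\subset Q$ a monoid prime. Fix a $P$-coprincipal congruence $\sim$ on $Q$ with cogenerator $w$, and write $\overline Q=Q/{\sim}$. Then $q,q'\in Q$ with distinct classes in $\overline Q$ are a protected witnesses pair for $\sim$ if and only if $(w:_\sim q)=(w:_\sim q')$.
   Context: Monoids. $Q$ is commutative and Noetherian, written additively. A congruence on $Q$ is an equivalence relation $\sim$ with $a\sim b\Rightarrow a+c\sim b+c$ for all $c\in Q$. An ideal of a monoid is a subset closed under adding arbitrary elements; $\langle q\rangle$ is the ideal generated by $q$. A nil is an absorbing element $\infty$; an element is nilpotent if some positive multiple is nil; $c$ is cancellative if $a+c=b+c\Rightarrow a=b$. A prime $P\subset Q$ is a proper, possibly empty, ideal whose complement is a submonoid. $Q_P$ is the localization of $Q$ along $P$ (inverting $Q\smallsetminus P$); $\bar q$ denotes the image of $q\in Q$ in $\overline Q=Q/{\sim}$ (or in $Q_P/{\sim}$ when so indicated). Green's preorder: $a\le b$ iff $\langle b\rangle\subseteq\langle a\rangle$. Witnesses. For a congruence $\sim$ and a prime $P$: $q\in Q$ is an aide for $w\in Q$ and a generator $p\in P$ if $\bar w\ne\bar q$, $\bar w+\bar p=\bar q+\bar p$, and $\bar q$ is maximal in the set $\{\bar q,\bar w\}$ (under Green's preorder); $q$ is a key aide for $w$ if it is an aide for $w$ for each generator of $P$; $w$ is a key witness for $P$ if it has a key aide. A key witness $w$ is a cogenerator of $\sim$ if $w+p$ is nil modulo $\sim$ for all $p\in P$. Two distinct key witnesses $a,b\in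 Q$ for a $P$-coprincipal congruence form a key witness pair if each is a key aide for the other. Congruences. $\sim$ is $P$-primary if every $p\in P$ is nilpotent in $\overline Q$ and every $f\in Q\smallsetminus P$ is cancellative in $\overline Q$. A $P$-primary congruence is mesoprimary if every element $q$ of $\overline Q$ is partly cancellative, i.e. $q+a=q+b\ne\infty\Rightarrow a=b$ for all cancellative $a,b\in\overline Q$. It is ($P$-)coprincipal if it is mesoprimary and every cogenerator for $\sim$ generates the same ideal in $\overline Q$. Soccular collapse. For a $P$-coprincipal congruence $\sim$ with cogenerator $w$, the (first) soccular collapse of $\sim$ is the congruence $\approx$ that sets $a\approx b$ if $a,b\notin\langle w\rangle$ and $a+p\sim b+p$ for all $p\in P$. The $i$-th soccular collapse of $\sim$ is the soccular collapse of the $(i-1)$st soccular collapse of $\sim$. Elements $a,b\in Q$ form a protected witnesses pair for $\sim$ if they form a key witness pair for some iterated soccular collapse of $\sim$. Notation: $(w:_\sim q)=\{p\in Q : \bar q+\bar p=\bar w\text{ in }Q_P/{\sim}\}$.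
   Formalization: The prime P is assumed nonempty (for empty P the claim fails for every pair with distinct classes), and "maximal" in the definition of aide means that no other class lies above, so distinct classes generating the same ideal are not maximal. *)

theory Defs
  imports Main
begin

text \<open>
  The monoid Q is the whole of a type of class \<^class>\<open>comm_monoid_add\<close>. A congruence is a
  binary predicate R on Q; statements about the quotient Q/R are expressed on
  representatives, with R in place of equality.
\<close>

definition congruence :: "('q::comm_monoid_add \<Rightarrow> 'q \<Rightarrow> bool) \<Rightarrow> bool" where
  "congruence R \<longleftrightarrow> equivp R \<and> (\<forall>a b c. R a b \<longrightarrow> R (a + c) (b + c))"

text \<open>Noetherian in the usual sense for commutative monoids: the ascending chain condition
  on congruences.\<close>

definition noetherian_monoid :: "'q::comm_monoid_add itself \<Rightarrow> bool" where
  "noetherian_monoid _ \<longleftrightarrow>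
     (\<forall>C :: nat \<Rightarrow> 'q \<Rightarrow> 'q \<Rightarrow> bool.
        (\<forall>i. congruence (C i)) \<and> mono C \<longrightarrow> (\<exists>n. \<forall>m\<ge>n. C m = C n))"

definition monoid_ideal :: "'q::comm_monoid_add set \<Rightarrow> bool" where
  "monoid_ideal I \<longleftrightarrow> (\<forall>a\<in>I. \<forall>c. a + c \<in> I)"

definition ideal_generated :: "'q::comm_monoid_add set \<Rightarrow> 'q set" where
  "ideal_generated G = {g + c | g c. g \<in> G}"

definition monoid_prime :: "'q::comm_monoid_add set \<Rightarrow> bool" where
  "monoid_prime P \<longleftrightarrow> monoid_ideal P \<and> P \<noteq> UNIV \<and>
     0 \<notin> P \<and> (\<forall>a b. a \<notin> P \<longrightarrow> b \<notin> P \<longrightarrow> a + b \<notin> P)"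

text \<open>The preimage in Q of the principal ideal of Q/R generated by the class of \<open>q\<close>.\<close>

definition qideal :: "('q::comm_monoid_add \<Rightarrow> 'q \<Rightarrow> bool) \<Rightarrow> 'q \<Rightarrow> 'q set" where
  "qideal R q = {a. \<exists>c. R a (q + c)}"

definition green_le :: "('q::comm_monoid_add \<Rightarrow> 'q \<Rightarrow> bool) \<Rightarrow> 'q \<Rightarrow> 'q \<Rightarrow> bool" where
  "green_le R a b \<longleftrightarrow> qideal R b \<subseteq> qideal R a"

definition nil_mod :: "('q::comm_monoid_add \<Rightarrow> 'q \<Rightarrow> bool) \<Rightarrow> 'q \<Rightarrow> bool" where
  "nil_mod R z \<longleftrightarrow> (\<forall>c. R (z + c) z)"

definition nilpotent_mod :: "('q::comm_monoid_add \<Rightarrow> 'q \<Rightarrow> bool) \<Rightarrow> 'q \<Rightarrow> bool" where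
  "nilpotent_mod R p \<longleftrightarrow> (\<exists>n>0. nil_mod R (\<Sum>i<(n::nat). p))"

definition cancellative_mod :: "('q::comm_monoid_add \<Rightarrow> 'q \<Rightarrow> bool) \<Rightarrow> 'q \<Rightarrow> bool" where
  "cancellative_mod R c \<longleftrightarrow> (\<forall>a b. R (a + c) (b + c) \<longrightarrow> R a b)"

definition partly_cancellative_mod ::
    "('q::comm_monoid_add \<Rightarrow> 'q \<Rightarrow> bool) \<Rightarrow> 'q \<Rightarrow> bool" where
  "partly_cancellative_mod R q \<longleftrightarrow>
     (\<forall>a b. cancellative_mod R a \<longrightarrow> cancellative_mod R b \<longrightarrow>
        R (q + a) (q + b) \<longrightarrow> \<not> nil_mod R (q + a) \<longrightarrow> R a b)"

text \<open>Green's preorder need not be antisymmetric on Q/R. The class of \<open>m\<close> is maximal among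
  the classes of elements of \<open>S\<close> if no \<^emph>\<open>other\<close> class lies above it; in particular two
  distinct classes generating the same ideal are not maximal in the set they form.\<close>

definition maximal_mod ::
    "('q::comm_monoid_add \<Rightarrow> 'q \<Rightarrow> bool) \<Rightarrow> 'q set \<Rightarrow> 'q \<Rightarrow> bool" where
  "maximal_mod R S m \<longleftrightarrow> m \<in> S \<and> (\<forall>x\<in>S. green_le R m x \<longrightarrow> R m x)"

definition aide ::
    "('q::comm_monoid_add \<Rightarrow> 'q \<Rightarrow> bool) \<Rightarrow> 'q \<Rightarrow> 'q \<Rightarrow> 'q \<Rightarrow> bool" where
  "aide R q w p \<longleftrightarrow> \<not> R w q \<and> R (w + p) (q + p) \<and> maximal_mod R {q, w} q"

text \<open>The choice of the generating set \<open>G\<close> of \<open>P\<close> is immaterial if \<open>P\<close> is nonempty: the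
  middle condition in \<^const>\<open>aide\<close> passes from \<open>p\<close> to \<open>p + c\<close>, the others do not involve
  \<open>p\<close>. For empty \<open>P\<close> the condition is vacuous.\<close>

definition key_aide ::
    "'q::comm_monoid_add set \<Rightarrow> ('q \<Rightarrow> 'q \<Rightarrow> bool) \<Rightarrow> 'q \<Rightarrow> 'q \<Rightarrow> bool" where
  "key_aide P R q w \<longleftrightarrow> (\<exists>G. ideal_generated G = P \<and> (\<forall>p\<in>G. aide R q w p))"

definition key_witness ::
    "'q::comm_monoid_add set \<Rightarrow> ('q \<Rightarrow> 'q \<Rightarrow> bool) \<Rightarrow> 'q \<Rightarrow> bool" where
  "key_witness P R w \<longleftrightarrow> (\<exists>q. key_aide P R q w)"

definition cogenerator ::
    "'q::comm_monoid_add set \<Rightarrow> ('q \<Rightarrow> 'q \<Rightarrow> bool) \<Rightarrow> 'q \<Rightarrow> bool" where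
  "cogenerator P R w \<longleftrightarrow> key_witness P R w \<and> (\<forall>p\<in>P. nil_mod R (w + p))"

definition key_witness_pair ::
    "'q::comm_monoid_add set \<Rightarrow> ('q \<Rightarrow> 'q \<Rightarrow> bool) \<Rightarrow> 'q \<Rightarrow> 'q \<Rightarrow> bool" where
  "key_witness_pair P R a b \<longleftrightarrow> a \<noteq> b \<and> key_witness P R a \<and> key_witness P R b \<and>
     key_aide P R a b \<and> key_aide P R b a"

definition primary_congruence ::
    "'q::comm_monoid_add set \<Rightarrow> ('q \<Rightarrow> 'q \<Rightarrow> bool) \<Rightarrow> bool" where
  "primary_congruence P R \<longleftrightarrow> congruence R \<and>
     (\<forall>p\<in>P. nilpotent_mod R p) \<and> (\<forall>f. f \<notin> P \<longrightarrow> cancellative_mod R f)"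

definition mesoprimary_congruence ::
    "'q::comm_monoid_add set \<Rightarrow> ('q \<Rightarrow> 'q \<Rightarrow> bool) \<Rightarrow> bool" where
  "mesoprimary_congruence P R \<longleftrightarrow>
     primary_congruence P R \<and> (\<forall>q. partly_cancellative_mod R q)"

definition coprincipal_congruence ::
    "'q::comm_monoid_add set \<Rightarrow> ('q \<Rightarrow> 'q \<Rightarrow> bool) \<Rightarrow> bool" where
  "coprincipal_congruence P R \<longleftrightarrow> mesoprimary_congruence P R \<and>
     (\<forall>v w. cogenerator P R v \<longrightarrow> cogenerator P R w \<longrightarrow> qideal R v = qideal R w)"

text \<open>The ideal generated by \<open>w\<close> is taken in Q/R. For a coprincipal congruence it does
  not depend on the cogenerator \<open>w\<close>, which is therefore not made a parameter; thus each step of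
  an iteration uses a cogenerator of the congruence being collapsed. The disjunct \<open>R a b\<close>
  makes the collapse coarser than R, and reflexive on the ideal of \<open>w\<close>.\<close>

definition soccular_collapse ::
    "'q::comm_monoid_add set \<Rightarrow> ('q \<Rightarrow> 'q \<Rightarrow> bool) \<Rightarrow> 'q \<Rightarrow> 'q \<Rightarrow> bool" where
  "soccular_collapse P R a b \<longleftrightarrow> R a b \<or>
     (\<exists>w. cogenerator P R w \<and> a \<notin> qideal R w \<and> b \<notin> qideal R w \<and>
          (\<forall>p\<in>P. R (a + p) (b + p)))"

text \<open>The iterates include the zeroth one, R itself.\<close>

definition protected_witnesses_pair ::
    "'q::comm_monoid_add set \<Rightarrow> ('q \<Rightarrow> 'q \<Rightarrow> bool) \<Rightarrow> 'q \<Rightarrow> 'q \<Rightarrow> bool" where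
  "protected_witnesses_pair P R a b \<longleftrightarrow>
     (\<exists>i. key_witness_pair P ((soccular_collapse P ^^ i) R) a b)"

text \<open>Equality in the localized quotient of Q along \<open>P\<close> modulo R. The pair \<open>(a, f)\<close>, with
  \<open>f\<close> outside \<open>P\<close>, stands for the formal difference \<open>a - f\<close>; an element \<open>q\<close> of Q maps to
  \<open>(q, 0)\<close>.\<close>

definition loc_eq ::
    "'q::comm_monoid_add set \<Rightarrow> ('q \<Rightarrow> 'q \<Rightarrow> bool) \<Rightarrow> 'q \<times> 'q \<Rightarrow> 'q \<times> 'q \<Rightarrow> bool" where
  "loc_eq P R = (\<lambda>(a, f) (b, g). \<exists>h. h \<notin> P \<and> R (a + g + h) (b + f + h))"

definition colon_set ::
    "'q::comm_monoid_add set \<Rightarrow> ('q \<Rightarrow> 'q \<Rightarrow> bool) \<Rightarrow> 'q \<Rightarrow> 'q \<Rightarrow> 'q set" where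
  "colon_set P R w q = {p. loc_eq P R (q + p, 0) (w, 0)}"

end

theory Submission
  imports Defs
begin

text \<open>
  Multiplying a cogenerator by an element outside \<open>P\<close> gives a cogenerator, so coprincipality makes
  every element outside \<open>P\<close> a unit modulo \<open>\<sim>\<close>. Hence the colon set of \<open>q\<close> is
  \<open>{p. q + p \<sim> w}\<close>, it is nonempty unless \<open>q\<close> is nil, and every iterated collapse lies between
  \<open>\<sim>\<close> and equality of colon sets. Any congruence in this range has the same nil class and the
  same cogenerators as \<open>\<sim>\<close>. The chain of collapses stabilizes by Noetherianity, and a congruence
  in this range that is its own collapse is equality of colon sets: a pair violating this could be
  translated to a violating pair that every \<open>p \<in> P\<close> joins, and such a pair is collapsed. So a pair
  with equal colon sets gets collapsed at some step, where it is a key witness pair.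
\<close>

section \<open>Congruences and their quotients\<close>

lemma congruence_refl: "congruence R \<Longrightarrow> R a a"
  by (simp add: congruence_def equivp_reflp)

lemma congruence_sym: "congruence R \<Longrightarrow> R a b \<Longrightarrow> R b a"
  by (meson congruence_def equivp_symp)

lemma congruence_trans: "congruence R \<Longrightarrow> R a b \<Longrightarrow> R b c \<Longrightarrow> R a c"
  by (meson congruence_def equivp_transp)

lemma congruence_add_right: "congruence R \<Longrightarrow> R a b \<Longrightarrow> R (a + c) (b + c)"
  by (simp add: congruence_def)

lemma congruence_add_left: "congruence R \<Longrightarrow> R a b \<Longrightarrow> R (c + a) (c + b)"
  by (metis add.commute congruence_add_right)

lemma congruenceI:
  assumes "\<And>a. R a a" "\<And>a b. R a b \<Longrightarrow> R b a" "\<And>a b c. R a b \<Longrightarrow> R b c \<Longrightarrow> R a c"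
    and "\<And>a b c. R a b \<Longrightarrow> R (a + c) (b + c)"
  shows "congruence R"
  unfolding congruence_def
  by (intro conjI equivpI reflpI sympI transpI allI impI) (fact assms)+

text \<open>There is at most one nil class, since the sum of two nils is congruent to both.\<close>

lemma nil_mod_iff:
  assumes "congruence R" "nil_mod R n"
  shows "nil_mod R z \<longleftrightarrow> R z n"
proof
  assume "nil_mod R z"
  then have "R (z + n) z"
    by (simp add: nil_mod_def)
  moreover have "R (z + n) n"
    using assms(2) by (simp add: nil_mod_def add.commute[of z n])
  ultimately show "R z n"
    using assms(1) congruence_sym congruence_trans by blast
next
  assume z: "R z n"
  show "nil_mod R z"
    unfolding nil_mod_def
  proof
    fix c
    have "R (z + c) (n + c)" "R (n + c) n" "R n z"
      using z assms congruence_add_right congruence_sym by (auto simp: nil_mod_def)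
    then show "R (z + c) z"
      using assms(1) congruence_trans by blast
  qed
qed

lemma nil_mod_add: "congruence R \<Longrightarrow> nil_mod R z \<Longrightarrow> nil_mod R (z + c)"
  by (simp add: nil_mod_iff[of R z]) (simp add: nil_mod_def)

lemma qideal_self: "congruence R \<Longrightarrow> a \<in> qideal R a"
  unfolding qideal_def by (metis (mono_tags, lifting) add_0_right congruence_refl mem_Collect_eq)

lemma qideal_cong: "congruence R \<Longrightarrow> R a b \<Longrightarrow> a \<in> qideal R c \<longleftrightarrow> b \<in> qideal R c"
  unfolding qideal_def mem_Collect_eq by (meson congruence_sym congruence_trans)

lemma qideal_add: "congruence R \<Longrightarrow> a \<in> qideal R c \<Longrightarrow> a + d \<in> qideal R c"
  unfolding qideal_def mem_Collect_eq by (metis add.assoc congruence_add_right)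

lemma green_le_iff:
  assumes "congruence R"
  shows "green_le R a b \<longleftrightarrow> b \<in> qideal R a"
proof
  assume "green_le R a b"
  then show "b \<in> qideal R a"
    using assms qideal_self by (auto simp: green_le_def)
next
  assume b: "b \<in> qideal R a"
  show "green_le R a b"
    unfolding green_le_def
  proof
    fix x
    assume "x \<in> qideal R b"
    then obtain c where "R x (b + c)"
      by (auto simp: qideal_def)
    then show "x \<in> qideal R a"
      using assms b qideal_add qideal_cong by blast
  qed
qed

lemma nil_mod_in_qideal: "congruence R \<Longrightarrow> nil_mod R z \<Longrightarrow> z \<in> qideal R a"
  using congruence_sym[of R "z + a" z]
  by (auto simp: nil_mod_def qideal_def add.commute intro!: exI[of _ z])

section \<open>Key aides and cogenerators\<close>

lemma ideal_generated_self: "monoid_ideal P \<Longrightarrow> ideal_generated P = P"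
  unfolding ideal_generated_def monoid_ideal_def
  by (auto, metis add_0_right)

text \<open>Being distinct from \<open>v\<close> and maximal in the pair means for \<open>q\<close>
  that \<open>v\<close> does not lie above it. A nonempty \<open>P\<close> has only nonempty
  generating sets, so this condition is never vacuous; conversely \<open>P\<close> serves as its own
  generating set.\<close>

lemma key_aide_iff:
  assumes "congruence R" "monoid_ideal P" "P \<noteq> {}"
  shows "key_aide P R q v \<longleftrightarrow> (\<forall>p\<in>P. R (v + p) (q + p)) \<and> v \<notin> qideal R q"
    (is "_ \<longleftrightarrow> ?A")
proof -
  have aide: "aide R q v p \<longleftrightarrow> R (v + p) (q + p) \<and> v \<notin> qideal R q" for p
    using assms(1) congruence_sym qideal_self[OF assms(1), of q] qideal_cong[OF assms(1)]
    by (auto simp: aide_def maximal_mod_def green_le_iff congruence_refl)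
  show ?thesis
  proof
    assume "key_aide P R q v"
    then obtain G where G: "ideal_generated G = P" "\<forall>p\<in>G. aide R q v p"
      by (auto simp: key_aide_def)
    have "R (v + p) (q + p)" if p: "p \<in> P" for p
    proof -
      obtain g c where "p = g + c" "g \<in> G"
        using p unfolding G(1)[symmetric] ideal_generated_def by blast
      then show ?thesis
        using G(2) aide congruence_add_right[OF assms(1)] by (metis add.assoc)
    qed
    moreover have "G \<noteq> {}"
      using G(1) assms(3) by (auto simp: ideal_generated_def)
    ultimately show ?A
      using G(2) aide by blast
  next
    assume ?A
    then show "key_aide P R q v"
      using aide ideal_generated_self[OF assms(2)] by (auto simp: key_aide_def)
  qed
qed

text \<open>Incomparability in Green's preorder already forces distinctness, and each element is the
  key aide that makes the other a key witness.\<close>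

lemma key_witness_pair_iff:
  assumes "congruence R" "monoid_ideal P" "P \<noteq> {}"
  shows "key_witness_pair P R a b \<longleftrightarrow>
    (\<forall>p\<in>P. R (a + p) (b + p)) \<and> a \<notin> qideal R b \<and> b \<notin> qideal R a"
  unfolding key_witness_pair_def key_witness_def key_aide_iff[OF assms]
  using qideal_self[OF assms(1)] congruence_sym[OF assms(1)] by metis

text \<open>The nil is a key aide for every element satisfying the right-hand side.\<close>

lemma cogenerator_iff:
  assumes "congruence R" "monoid_ideal P" "P \<noteq> {}" "nil_mod R n"
  shows "cogenerator P R v \<longleftrightarrow> \<not> nil_mod R v \<and> (\<forall>p\<in>P. nil_mod R (v + p))"
proof
  assume "cogenerator P R v"
  then show "\<not> nil_mod R v \<and> (\<forall>p\<in>P. nil_mod R (v + p))"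
    using nil_mod_in_qideal[OF assms(1)]
    by (auto simp: cogenerator_def key_witness_def key_aide_iff[OF assms(1-3)])
next
  assume v: "\<not> nil_mod R v \<and> (\<forall>p\<in>P. nil_mod R (v + p))"
  have "v \<notin> qideal R n"
    using v assms(1,4) nil_mod_add nil_mod_iff unfolding qideal_def mem_Collect_eq by blast
  moreover have "R (v + p) (n + p)" if "p \<in> P" for p
    using v that assms(1,4) nil_mod_add nil_mod_iff by blast
  ultimately have "key_aide P R n v"
    by (simp add: key_aide_iff[OF assms(1-3)])
  then show "cogenerator P R v"
    using v by (auto simp: cogenerator_def key_witness_def)
qed

section \<open>Consequences of the ascending chain condition\<close>

text \<open>Empty and one-element ideals have the same Rees congruence, hence the nonemptiness.\<close>

lemma noetherian_maximal_ideal: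
  fixes F :: "'q::comm_monoid_add set set"
  assumes noeth: "noetherian_monoid TYPE('q)" and "F \<noteq> {}"
    and F: "\<And>I. I \<in> F \<Longrightarrow> monoid_ideal I \<and> I \<noteq> {}"
  obtains M where "M \<in> F" "\<And>I. I \<in> F \<Longrightarrow> M \<subseteq> I \<Longrightarrow> I = M"
proof (rule ccontr)
  note * = that
  assume "\<not> thesis"
  then have "\<exists>I. I \<in> F \<and> M \<subset> I" if "M \<in> F" for M
    using *[OF that] by (metis psubsetI)
  then obtain f where f: "\<And>M. M \<in> F \<Longrightarrow> f M \<in> F" "\<And>M. M \<in> F \<Longrightarrow> M \<subset> f M"
    by metis
  obtain M0 where "M0 \<in> F"
    using assms(2) by blast
  define J where "J k = (f ^^ k) M0" for k
  have JF: "J k \<in> F" for k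
    by (induction k) (simp_all add: J_def f(1) \<open>M0 \<in> F\<close>)
  have step: "J k \<subset> J (Suc k)" for k
    using f(2)[OF JF[of k]] by (simp add: J_def)
  define rees where "rees k x y \<longleftrightarrow> x = y \<or> x \<in> J k \<and> y \<in> J k" for k x y
  have J_add: "x + c \<in> J k" if "x \<in> J k" for x c k
    using that F[OF JF[of k]] by (simp add: monoid_ideal_def)
  have "congruence (rees k)" for k
    by (rule congruenceI) (auto simp: rees_def J_add)
  moreover have "mono rees"
    unfolding mono_iff_le_Suc
  proof (intro allI le_funI le_boolI)
    fix k x y
    assume "rees k x y"
    moreover have "J k \<subseteq> J (Suc k)"
      using step by (rule psubset_imp_subset)
    ultimately show "rees (Suc k) x y"
      unfolding rees_def by blast
  qed
  ultimately obtain k where k: "\<forall>m\<ge>k. rees m = rees k"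
    using noeth unfolding noetherian_monoid_def by blast
  obtain x where "x \<in> J (Suc k)" "x \<notin> J k"
    using step[of k] by blast
  moreover obtain y where "y \<in> J k"
    using F[OF JF[of k]] by blast
  moreover have "rees (Suc k) = rees k"
    using k le_SucI by blast
  moreover have "rees (Suc k) x y"
    using \<open>x \<in> J (Suc k)\<close> \<open>y \<in> J k\<close> step[of k] by (auto simp: rees_def)
  ultimately have "rees k x y"
    by simp
  then show False
    using \<open>x \<notin> J k\<close> \<open>y \<in> J k\<close> by (auto simp: rees_def)
qed

text \<open>Among the \<open>c\<close> with \<open>q + c\<close> outside \<open>I\<close>, one works
  for which the ideal of elements carrying \<open>q + c\<close> into \<open>I\<close> is maximal.
  With the nil elements as \<open>I\<close> this yields cogenerators; with the translations that
  join two given elements it yields a pair ready to be collapsed.\<close>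

lemma noetherian_socle_element:
  fixes I P :: "'q::comm_monoid_add set"
  assumes noeth: "noetherian_monoid TYPE('q)" and I: "monoid_ideal I" "I \<noteq> {}"
    and rad: "\<And>p. p \<in> P \<Longrightarrow> \<exists>n. (\<Sum>i<(n::nat). p) \<in> I"
    and q: "q \<notin> I"
  obtains c where "q + c \<notin> I" "\<And>p. p \<in> P \<Longrightarrow> q + c + p \<in> I"
proof -
  define J where "J c = {x. q + c + x \<in> I}" for c
  have Iadd: "x + y \<in> I" "y + x \<in> I" if "x \<in> I" for x y
    using I(1) that by (auto simp: monoid_ideal_def add.commute)
  have J: "monoid_ideal (J c) \<and> J c \<noteq> {}" for c
  proof
    show "monoid_ideal (J c)"
      unfolding monoid_ideal_def J_def by (simp add: Iadd(1) flip: add.assoc)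
    show "J c \<noteq> {}"
    proof -
      obtain x where "x \<in> I"
        using I(2) by blast
      then have "x \<in> J c"
        by (simp add: J_def Iadd(2))
      then show ?thesis
        by blast
    qed
  qed
  let ?F = "J ` {c. q + c \<notin> I}"
  have "J 0 \<in> ?F"
    using q by simp
  then have "?F \<noteq> {}"
    by blast
  moreover have "monoid_ideal K \<and> K \<noteq> {}" if "K \<in> ?F" for K
    using that J by (elim imageE) simp
  ultimately obtain M where M: "M \<in> ?F" "\<And>K. K \<in> ?F \<Longrightarrow> M \<subseteq> K \<Longrightarrow> K = M"
    using noetherian_maximal_ideal[OF noeth, of ?F] by metis
  from M(1) obtain c where c: "q + c \<notin> I" and "M = J c"
    by (elim imageE) simp
  have c_max: "J d = J c" if "q + d \<notin> I" "J c \<subseteq> J d" for d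
    using M(2)[of "J d"] that \<open>M = J c\<close> by simp
  have "q + c + p \<in> I" if p: "p \<in> P" for p
  proof (rule ccontr)
    assume "q + c + p \<notin> I"
    \<comment> \<open>Walk from \<open>q + c\<close> along the multiples of \<open>p\<close>: since
      some multiple lies in \<open>I\<close>, the walk enters \<open>I\<close> at some step after
      \<open>s k\<close>.\<close>
    define s where "s k = q + c + (\<Sum>i<(k::nat). p)" for k
    obtain n where "(\<Sum>i<(n::nat). p) \<in> I"
      using rad[OF p] by blast
    then have "s n \<in> I"
      by (simp add: s_def Iadd(2))
    moreover have "s 0 \<notin> I"
      using c by (simp add: s_def)
    ultimately have "\<exists>k. s k \<notin> I \<and> s (Suc k) \<in> I"
      by (induction n) blast+
    then obtain k where k: "s k \<notin> I" "s (Suc k) \<in> I"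
      by blast
    have "J c \<subseteq> J (c + (\<Sum>i<k. p))"
    proof
      fix x
      assume "x \<in> J c"
      then have "q + c + x + (\<Sum>i<k. p) \<in> I"
        by (simp add: J_def Iadd)
      then show "x \<in> J (c + (\<Sum>i<k. p))"
        by (simp add: J_def ac_simps)
    qed
    \<comment> \<open>Maximality lets no new element appear, yet \<open>p\<close> is one, because
      the step from \<open>s k\<close> along \<open>p\<close> enters \<open>I\<close>.\<close>
    then have "J (c + (\<Sum>i<k. p)) = J c"
      using c_max k(1) by (simp add: s_def add.assoc)
    moreover have "p \<in> J (c + (\<Sum>i<k. p))"
      using k(2) by (simp add: J_def s_def add.assoc)
    ultimately show False
      using \<open>q + c + p \<notin> I\<close> by (simp add: J_def)
  qed
  with c show thesis
    using that by blast
qed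

section \<open>Coprincipal congruences\<close>

locale coprincipal =
  fixes P :: "'q::comm_monoid_add set" and R :: "'q \<Rightarrow> 'q \<Rightarrow> bool" and w :: 'q
  assumes noeth: "noetherian_monoid TYPE('q)"
    and prime: "monoid_prime P"
    and nonempty: "P \<noteq> {}"
    and coprinc: "coprincipal_congruence P R"
    and cogen: "cogenerator P R w"
begin

lemma ideal_P: "monoid_ideal P"
  using prime by (simp add: monoid_prime_def)

lemma zero_notin: "0 \<notin> P"
  using prime by (simp add: monoid_prime_def)

lemma mesoprimary: "mesoprimary_congruence P R"
  using coprinc by (simp add: coprincipal_congruence_def)

lemma cong: "congruence R"
  using mesoprimary by (simp add: mesoprimary_congruence_def primary_congruence_def)

lemmas R_sym = congruence_sym[OF cong]
  and R_trans = congruence_trans[OF cong]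

lemma nilpotent: "p \<in> P \<Longrightarrow> nilpotent_mod R p"
  using mesoprimary by (simp add: mesoprimary_congruence_def primary_congruence_def)

lemma cancellative: "f \<notin> P \<Longrightarrow> cancellative_mod R f"
  using mesoprimary by (simp add: mesoprimary_congruence_def primary_congruence_def)

lemma cancel:
  assumes "f \<notin> P" "R (a + f) (b + f)"
  shows "R a b"
  using cancellative[OF assms(1), unfolded cancellative_mod_def, rule_format, OF assms(2)] .

lemma partly_cancel:
  assumes "a \<notin> P" "b \<notin> P" "R (x + a) (x + b)" "\<not> nil_mod R (x + a)"
  shows "R a b"
proof -
  have "partly_cancellative_mod R x"
    using mesoprimary by (simp add: mesoprimary_congruence_def)
  then show ?thesis
    using assms cancellative[OF assms(1)] cancellative[OF assms(2)]
    unfolding partly_cancellative_mod_def by iprover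
qed

text \<open>All nils are congruent, so the choice of representative is immaterial; one exists
  because \<open>P\<close> contains a nilpotent element.\<close>

definition nil :: 'q where
  "nil = (SOME n. nil_mod R n)"

lemma nil: "nil_mod R nil"
proof -
  obtain p where "p \<in> P"
    using nonempty by blast
  then obtain n where "nil_mod R (\<Sum>i<(n::nat). p)"
    using nilpotent unfolding nilpotent_mod_def by blast
  then show ?thesis
    unfolding nil_def by (rule someI)
qed

lemma cogenerator_R: "cogenerator P R v \<longleftrightarrow> \<not> nil_mod R v \<and> (\<forall>p\<in>P. nil_mod R (v + p))"
  by (rule cogenerator_iff[OF cong ideal_P nonempty nil])

lemma w_not_nil: "\<not> nil_mod R w"
  and w_socle: "p \<in> P \<Longrightarrow> nil_mod R (w + p)"
  using cogen by (auto simp: cogenerator_R)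

lemma cogenerator_qideal: "cogenerator P R v \<Longrightarrow> qideal R v = qideal R w"
  using coprinc cogen unfolding coprincipal_congruence_def by blast

lemma R_iff: "R a b \<Longrightarrow> R a c \<longleftrightarrow> R b c"
  by (rule iffI) (erule (1) R_trans[OF R_sym], erule (1) R_trans)

lemma nil_mod_cong: "R a b \<Longrightarrow> nil_mod R a \<longleftrightarrow> nil_mod R b"
  unfolding nil_mod_iff[OF cong nil] by (rule R_iff)

text \<open>The element \<open>w + f\<close> is again a cogenerator, so its ideal contains
  \<open>w\<close>. This gives \<open>w + (f + g)\<close> congruent to \<open>w\<close>, where
  \<open>f + g\<close> avoids \<open>P\<close> because otherwise \<open>w\<close> would be nil, and
  partial cancellation at \<open>w\<close> finishes.\<close>

lemma unit:
  assumes f: "f \<notin> P"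
  obtains g where "g \<notin> P" "R (f + g) 0"
proof -
  have "\<not> nil_mod R (w + f)"
  proof
    assume nf: "nil_mod R (w + f)"
    have "R (w + f) (nil + f)"
      using nf nil_mod_iff[OF cong nil_mod_add[OF cong nil]] by blast
    then have "R w nil"
      using f by (rule cancel[rotated])
    then show False
      using w_not_nil nil_mod_iff[OF cong nil] by blast
  qed
  moreover have "nil_mod R (w + f + p)" if "p \<in> P" for p
    using nil_mod_add[OF cong w_socle[OF that], of f] by (simp add: ac_simps)
  ultimately have "w \<in> qideal R (w + f)"
    using cogenerator_qideal[of "w + f"] qideal_self[OF cong, of w] by (simp add: cogenerator_R)
  then obtain g where "R w (w + f + g)"
    by (auto simp: qideal_def)
  then have g: "R (w + (f + g)) (w + 0)"
    using R_sym[of w] by (simp add: add.assoc)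
  then have not_nil: "\<not> nil_mod R (w + (f + g))"
    using w_not_nil nil_mod_cong[OF g] by simp
  then have "f + g \<notin> P"
    using w_socle by blast
  with not_nil have "R (f + g) 0"
    using partly_cancel[OF _ zero_notin g] by blast
  moreover have "g \<notin> P"
    using \<open>f + g \<notin> P\<close> ideal_P unfolding monoid_ideal_def by (metis add.commute)
  ultimately show thesis
    using that by blast
qed

section \<open>Colon sets and the ideal of \<open>w\<close>\<close>

lemma colon_set_iff: "p \<in> colon_set P R w q \<longleftrightarrow> R (q + p) w"
proof -
  \<comment> \<open>Elements outside \<open>P\<close> are cancellative, so localizing identifies no
    further classes.\<close>
  have "(\<exists>h. h \<notin> P \<and> R (q + p + h) (w + h)) \<longleftrightarrow> R (q + p) w"
    using cancel congruence_add_right[OF cong] zero_notin by (meson)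
  then show ?thesis
    by (simp add: colon_set_def loc_eq_def)
qed

lemma colon_nil: "nil_mod R a \<Longrightarrow> colon_set P R w a = {}"
  using w_not_nil nil_mod_cong nil_mod_add[OF cong] unfolding set_eq_iff colon_set_iff by blast

text \<open>A non-nil \<open>a\<close> has a multiple that is a cogenerator, and by coprincipality
  \<open>w\<close> is a multiple of that one.\<close>

lemma colon_nonempty:
  assumes "\<not> nil_mod R a"
  shows "colon_set P R w a \<noteq> {}"
proof -
  have I: "monoid_ideal {x. nil_mod R x}"
    by (auto simp: monoid_ideal_def nil_mod_add[OF cong])
  have ne: "{x. nil_mod R x} \<noteq> {}"
    using nil by blast
  have rad: "\<exists>n. (\<Sum>i<(n::nat). p) \<in> {x. nil_mod R x}" if "p \<in> P" for p
    using nilpotent[OF that] by (auto simp: nilpotent_mod_def)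
  have "a \<notin> {x. nil_mod R x}"
    using assms by simp
  then obtain c where "a + c \<notin> {x. nil_mod R x}" "\<And>p. p \<in> P \<Longrightarrow> a + c + p \<in> {x. nil_mod R x}"
    using noetherian_socle_element[OF noeth I ne rad] by metis
  then have "cogenerator P R (a + c)"
    by (simp add: cogenerator_R)
  then have "w \<in> qideal R (a + c)"
    using cogenerator_qideal qideal_self[OF cong] by blast
  then obtain d where "R w (a + c + d)"
    by (auto simp: qideal_def)
  then have "c + d \<in> colon_set P R w a"
    using R_sym[of w] by (simp add: colon_set_iff add.assoc)
  then show ?thesis
    by blast
qed

lemma colon_empty_iff: "colon_set P R w a = {} \<longleftrightarrow> nil_mod R a"
  using colon_nil colon_nonempty by blast

lemma colon_cong: "R a b \<Longrightarrow> colon_set P R w a = colon_set P R w b"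
  unfolding set_eq_iff colon_set_iff
  using R_iff[OF congruence_add_right[OF cong]] by simp

lemma colon_add_eq:
  "colon_set P R w a = colon_set P R w b \<Longrightarrow> colon_set P R w (a + c) = colon_set P R w (b + c)"
  unfolding set_eq_iff colon_set_iff by (simp add: add.assoc)

text \<open>Together with \<open>colon_unit_qideal_w\<close> this recognizes the non-nil elements of
  the ideal of \<open>w\<close> from their colon sets: they are those whose colon set meets the
  complement of \<open>P\<close>.\<close>

lemma qideal_w_cases:
  assumes "a \<in> qideal R w" "\<not> nil_mod R a"
  obtains f where "f \<notin> P" "R (a + f) w"
proof -
  obtain g where g: "R a (w + g)"
    using assms(1) by (auto simp: qideal_def)
  then have "g \<notin> P"
    using assms(2) w_socle nil_mod_cong by blast
  then obtain f where f: "f \<notin> P" "R (g + f) 0"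
    using unit by blast
  have "R (a + f) (w + (g + f))"
    using congruence_add_right[OF cong g, of f] by (simp add: add.assoc)
  moreover have "R (w + (g + f)) w"
    using congruence_add_left[OF cong f(2), of w] by simp
  ultimately show thesis
    using that f(1) R_trans by blast
qed

lemma colon_unit_qideal_w:
  assumes "f \<notin> P" "R (a + f) w"
  shows "a \<in> qideal R w"
proof -
  obtain g where g: "R (f + g) 0"
    using unit assms(1) by blast
  have "R (a + (f + g)) (w + g)"
    using congruence_add_right[OF cong assms(2), of g] by (simp add: add.assoc)
  moreover have "R (a + (f + g)) a"
    using congruence_add_left[OF cong g, of a] by simp
  ultimately have "R a (w + g)"
    using R_sym R_trans by blast
  then show ?thesis
    by (auto simp: qideal_def)
qed

text \<open>A common element \<open>f\<close> of the colon sets outside \<open>P\<close> can be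
  cancelled. Hence no congruence finer than equality of colon sets identifies anything new in the
  ideal of \<open>w\<close>.\<close>

lemma colon_eq_qideal_w:
  assumes eq: "colon_set P R w a = colon_set P R w b" and a: "a \<in> qideal R w"
  shows "R a b"
proof (cases "nil_mod R a")
  case True
  then have "nil_mod R b"
    using eq by (simp flip: colon_empty_iff)
  with True show ?thesis
    using nil_mod_iff[OF cong] by blast
next
  case False
  then obtain f where f: "f \<notin> P" "R (a + f) w"
    using a qideal_w_cases by blast
  then have "R (b + f) w"
    using eq by (simp flip: colon_set_iff)
  then have "R (a + f) (b + f)"
    using f(2) R_iff R_sym by blast
  then show ?thesis
    by (rule cancel[OF f(1)])
qed

text \<open>A common element of both colon sets shows that \<open>w + c\<close> is congruent to
  \<open>w\<close>, and \<open>w\<close> is partly cancellative. This later excludes comparable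
  pairs with equal colon sets.\<close>

lemma colon_eq_add:
  assumes "colon_set P R w (b + c) = colon_set P R w b" "\<not> nil_mod R b"
  shows "R c 0"
proof -
  obtain p where p: "p \<in> colon_set P R w b"
    using assms(2) colon_nonempty by blast
  then have "R (b + p) w" "R (b + p + c) w"
    using p[folded assms(1)] by (simp_all add: colon_set_iff ac_simps)
  then have wc: "R (w + c) (w + 0)"
    using R_iff[OF congruence_add_right[OF cong, of "b + p" w c]] by simp
  then have "\<not> nil_mod R (w + c)"
    using w_not_nil nil_mod_cong[OF wc] by simp
  then show ?thesis
    using partly_cancel[OF _ zero_notin wc] w_socle by blast
qed

section \<open>Congruences between \<open>R\<close> and equality of colon sets\<close>

text \<open>The invariant of the iteration. Its upper bound keeps the nil class and the ideal of
  \<open>w\<close> fixed while other classes merge.\<close>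

definition between :: "('q \<Rightarrow> 'q \<Rightarrow> bool) \<Rightarrow> bool" where
  "between S \<longleftrightarrow> congruence S \<and> R \<le> S \<and>
     (\<forall>a b. S a b \<longrightarrow> colon_set P R w a = colon_set P R w b)"

lemma between_cong: "between S \<Longrightarrow> congruence S"
  and between_le: "between S \<Longrightarrow> R a b \<Longrightarrow> S a b"
  and between_colon: "between S \<Longrightarrow> S a b \<Longrightarrow> colon_set P R w a = colon_set P R w b"
  by (auto simp: between_def)

lemma between_R: "between R"
  using cong colon_cong by (simp add: between_def)

text \<open>A coarser congruence could create nils; the upper bound prevents this, as the nils are
  exactly the elements with empty colon set.\<close>

lemma between_nil: "between S \<Longrightarrow> nil_mod S z \<longleftrightarrow> nil_mod R z"
proof
  assume S: "between S"
  then have n: "nil_mod S nil"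
    using nil by (auto simp: nil_mod_def intro: between_le)
  assume "nil_mod S z"
  then have "S z nil"
    using nil_mod_iff[OF between_cong[OF S] n] by blast
  then show "nil_mod R z"
    using between_colon[OF S] nil by (metis colon_empty_iff)
qed (auto simp: nil_mod_def intro: between_le)

lemma between_cogenerator:
  assumes "between S"
  shows "cogenerator P S v \<longleftrightarrow> cogenerator P R v"
  using cogenerator_iff[OF between_cong[OF assms] ideal_P nonempty, of nil] nil
  by (simp add: cogenerator_R between_nil[OF assms])

lemma between_qideal_cogenerator:
  assumes S: "between S" and v: "cogenerator P R v"
  shows "qideal S v = qideal R w"
proof -
  have "R a (v + c)" if "S a (v + c)" for a c
  proof -
    have "v + c \<in> qideal R w"
      using v cogenerator_qideal qideal_add[OF cong qideal_self[OF cong]] by blast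
    then have "R (v + c) a"
      using colon_eq_qideal_w between_colon[OF S that] by simp
    then show ?thesis
      using R_sym by blast
  qed
  then have "qideal S v = qideal R v"
    using between_le[OF S] unfolding qideal_def by blast
  then show ?thesis
    using cogenerator_qideal v by simp
qed

section \<open>One collapse step preserves the invariant\<close>

lemma soccular_collapse_iff:
  assumes "between S"
  shows "soccular_collapse P S a b \<longleftrightarrow>
    S a b \<or> a \<notin> qideal R w \<and> b \<notin> qideal R w \<and> (\<forall>p\<in>P. S (a + p) (b + p))"
  \<comment> \<open>\<open>S\<close> has the cogenerators of \<open>R\<close>, all generating the
    same ideal, so every step of the iteration excludes one fixed set.\<close>
  using cogen between_qideal_cogenerator[OF assms]
  by (auto simp: soccular_collapse_def between_cogenerator[OF assms])

lemma qideal_w_between_cong: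
  assumes "between S" "S a b"
  shows "a \<in> qideal R w \<longleftrightarrow> b \<in> qideal R w"
  using assms between_colon colon_eq_qideal_w qideal_cong[OF cong] by metis

lemma qideal_w_add_unit:
  assumes c: "c \<notin> P"
  shows "a + c \<in> qideal R w \<longleftrightarrow> a \<in> qideal R w"
proof
  assume ac: "a + c \<in> qideal R w"
  obtain g where "R (c + g) 0"
    using unit c by blast
  then have "R (a + c + g) a"
    using congruence_add_left[OF cong, of "c + g" 0 a] by (simp add: add.assoc)
  then show "a \<in> qideal R w"
    using qideal_add[OF cong ac, of g] qideal_cong[OF cong] by blast
qed (simp add: qideal_add[OF cong])

lemma soccular_collapse_congruence:
  assumes S: "between S"
  shows "congruence (soccular_collapse P S)"
proof -
  note it = soccular_collapse_iff[OF S]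
  note SC = between_cong[OF S]
  note add = congruence_add_right[OF SC]
  have mem: "a \<in> qideal R w \<longleftrightarrow> b \<in> qideal R w" if "soccular_collapse P S a b" for a b
    using that qideal_w_between_cong[OF S, of a b] unfolding it by blast
  have tr: "S (a + p) (b + p)" if "soccular_collapse P S a b" "p \<in> P" for a b p
    using that add[of a b p] unfolding it by blast
  show ?thesis
  proof (rule congruenceI)
    show "soccular_collapse P S a a" for a
      using congruence_refl[OF SC] by (simp add: it)
    show "soccular_collapse P S b a" if ab: "soccular_collapse P S a b" for a b
    proof (cases "S a b")
      case True
      then show ?thesis
        using congruence_sym[OF SC, of a b] by (simp add: it)
    next
      case False
      moreover have "S (b + p) (a + p)" if "p \<in> P" for p
        using tr[OF ab that] by (rule congruence_sym[OF SC])
      ultimately show ?thesis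
        using ab by (simp add: it)
    qed
    show "soccular_collapse P S a c"
      if ab: "soccular_collapse P S a b" and bc: "soccular_collapse P S b c" for a b c
    proof (cases "a \<in> qideal R w")
      \<comment> \<open>Related elements lie both inside or both outside the ideal of
        \<open>w\<close>. Inside, both links already hold in \<open>S\<close>; outside, they are
        compared after adding elements of \<open>P\<close>.\<close>
      case True
      then have "S a b" "S b c"
        using ab bc mem[OF ab] by (simp_all add: it)
      then have "S a c"
        by (rule congruence_trans[OF SC])
      then show ?thesis
        by (simp add: it)
    next
      case False
      moreover have "S (a + p) (c + p)" if "p \<in> P" for p
        using tr[OF ab that] tr[OF bc that] by (rule congruence_trans[OF SC])
      ultimately show ?thesis
        using mem[OF ab] mem[OF bc] by (simp add: it)
    qed
    show "soccular_collapse P S (a + c) (b + c)" if ab: "soccular_collapse P S a b" for a b c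
    proof (cases "S a b \<or> c \<in> P")
      case True
      then have "S (a + c) (b + c)"
        using add tr[OF ab] by blast
      then show ?thesis
        by (simp add: it)
    next
      \<comment> \<open>Now \<open>c\<close> is a unit modulo \<open>R\<close>, so adding it keeps
        both elements outside the ideal of \<open>w\<close>.\<close>
      case False
      have "S (a + c + p) (b + c + p)" if "p \<in> P" for p
        using add[OF tr[OF ab that], of c] by (simp add: ac_simps)
      then show ?thesis
        using False ab by (auto simp: it qideal_w_add_unit)
    qed
  qed
qed

text \<open>The elements of \<open>P\<close> in the two colon sets agree; an element outside \<open>P\<close> in one of them would
  put \<open>a\<close> or \<open>b\<close> into the ideal of \<open>w\<close>.\<close>

lemma collapsed_colon_eq:
  assumes S: "between S" and w: "a \<notin> qideal R w" "b \<notin> qideal R w"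
    and ab: "\<And>p. p \<in> P \<Longrightarrow> S (a + p) (b + p)"
  shows "colon_set P R w a = colon_set P R w b"
proof (intro set_eqI)
  fix p
  show "p \<in> colon_set P R w a \<longleftrightarrow> p \<in> colon_set P R w b"
  proof (cases "p \<in> P")
    case True
    \<comment> \<open>Membership of \<open>p\<close> for \<open>a\<close> is membership of 0 for
      \<open>a + p\<close>, which depends only on the \<open>S\<close>-class of
      \<open>a + p\<close>.\<close>
    have "0 \<in> colon_set P R w (a + p) \<longleftrightarrow> 0 \<in> colon_set P R w (b + p)"
      using between_colon[OF S ab[OF True]] by simp
    then show ?thesis
      by (simp add: colon_set_iff)
  next
    case False
    then show ?thesis
      using w colon_unit_qideal_w by (auto simp: colon_set_iff)
  qed
qed

lemma between_soccular_collapse: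
  assumes S: "between S"
  shows "between (soccular_collapse P S)"
  unfolding between_def
  using soccular_collapse_congruence[OF S] between_le[OF S] between_colon[OF S]
    collapsed_colon_eq[OF S]
  by (auto simp: soccular_collapse_iff[OF S])

lemma between_iterate: "between ((soccular_collapse P ^^ i) R)"
  by (induction i) (auto intro: between_R between_soccular_collapse)

section \<open>Stable collapses and the two implications\<close>

lemma collapse_fixpoint:
  assumes S: "between S" and fixpoint: "soccular_collapse P S = S"
    and eq: "colon_set P R w a = colon_set P R w b"
  shows "S a b"
proof (rule ccontr)
  assume "\<not> S a b"
  \<comment> \<open>The translations that join \<open>a\<close> and \<open>b\<close> form an ideal
    containing all nils, so each element of \<open>P\<close> has a multiple in it.\<close>
  define I where "I = {x. S (a + x) (b + x)}"
  note SC = between_cong[OF S]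
  have nilI: "x \<in> I" if "nil_mod R x" for x
  proof -
    have "nil_mod R (a + x)" "nil_mod R (b + x)"
      using nil_mod_add[OF cong that] by (simp_all add: add.commute)
    then show ?thesis
      using nil_mod_iff[OF cong] between_le[OF S] by (auto simp: I_def)
  qed
  have I: "monoid_ideal I"
    using congruence_add_right[OF SC] by (auto simp: monoid_ideal_def I_def simp flip: add.assoc)
  have ne: "I \<noteq> {}"
    using nilI nil by blast
  have rad: "\<exists>n. (\<Sum>i<(n::nat). p) \<in> I" if "p \<in> P" for p
    using nilpotent[OF that] nilI by (auto simp: nilpotent_mod_def)
  have "0 \<notin> I"
    using \<open>\<not> S a b\<close> by (simp add: I_def)
  then obtain c where "0 + c \<notin> I" "\<And>p. p \<in> P \<Longrightarrow> 0 + c + p \<in> I"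
    using noetherian_socle_element[OF noeth I ne rad] by metis
  then have c: "\<not> S (a + c) (b + c)" "\<And>p. p \<in> P \<Longrightarrow> S (a + c + p) (b + c + p)"
    by (simp_all add: I_def add.assoc)
  have "colon_set P R w (a + c) = colon_set P R w (b + c)"
    using eq by (rule colon_add_eq)
  \<comment> \<open>Inside the ideal of \<open>w\<close>, equal colon sets would force congruence
    modulo \<open>R\<close>, hence modulo \<open>S\<close>.\<close>
  then have "a + c \<notin> qideal R w" "b + c \<notin> qideal R w"
    using c(1) colon_eq_qideal_w between_le[OF S] congruence_sym[OF SC] by metis+
  then have "soccular_collapse P S (a + c) (b + c)"
    using c(2) by (simp add: soccular_collapse_iff[OF S])
  then show False
    using c(1) fixpoint by simp
qed

lemma key_witness_pair_between_colon_eq: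
  assumes S: "between S" and ab: "key_witness_pair P S a b"
  shows "colon_set P R w a = colon_set P R w b"
proof -
  note SC = between_cong[OF S]
  have p: "\<And>p. p \<in> P \<Longrightarrow> S (a + p) (b + p)" and inc: "a \<notin> qideal S b" "b \<notin> qideal S a"
    using ab by (auto simp: key_witness_pair_iff[OF SC ideal_P nonempty])
  have not_nil: "\<not> nil_mod R a" "\<not> nil_mod R b"
    using inc nil_mod_in_qideal[OF SC] by (auto simp: between_nil[OF S])
  have socle: "nil_mod R (x + p)" if x: "x \<in> qideal R w" and p: "p \<in> P" for x p
  proof -
    obtain c where "R x (w + c)"
      using x by (auto simp: qideal_def)
    then have "R (x + p) (w + p + c)"
      using congruence_add_right[OF cong, of x "w + c" p] by (simp add: ac_simps)
    then show ?thesis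
      using nil_mod_add[OF cong w_socle[OF p]] nil_mod_cong by blast
  qed
  have nil_iff: "nil_mod R (a + p) \<longleftrightarrow> nil_mod R (b + p)" if "p \<in> P" for p
    using between_colon[OF S p[OF that]] by (simp flip: colon_empty_iff)
  \<comment> \<open>Two cogenerators generate the same ideal modulo \<open>S\<close>, against
    incomparability.\<close>
  have "\<not> (cogenerator P R a \<and> cogenerator P R b)"
    using inc between_qideal_cogenerator[OF S] qideal_self[OF SC, of a] by blast
  \<comment> \<open>If one of the two were in the ideal of \<open>w\<close>, adding any element of
    \<open>P\<close> would make it nil, and with it the other; both would be cogenerators.\<close>
  then have "a \<notin> qideal R w" "b \<notin> qideal R w"
    using socle nil_iff not_nil by (auto simp: cogenerator_R)
  then show ?thesis
    using collapsed_colon_eq[OF S] p by blast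
qed

lemma colon_eq_protected:
  assumes ne: "\<not> R a b" and eq: "colon_set P R w a = colon_set P R w b"
  shows "protected_witnesses_pair P R a b"
proof -
  define T where "T i = (soccular_collapse P ^^ i) R" for i
  have T: "between (T i)" for i
    by (simp add: T_def between_iterate)
  have T_Suc: "T (Suc i) = soccular_collapse P (T i)" for i
    by (simp add: T_def)
  have "mono T"
    unfolding mono_iff_le_Suc T_Suc by (auto simp: soccular_collapse_def)
  then obtain n where "\<forall>m\<ge>n. T m = T n"
    using noeth between_cong[OF T] unfolding noetherian_monoid_def by blast
  then have "T (Suc n) = T n"
    using le_SucI by blast
  then have "soccular_collapse P (T n) = T n"
    by (simp add: T_Suc)
  then have "T n a b"
    using collapse_fixpoint[OF T] eq by blast
  moreover have "\<not> T 0 a b"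
    using ne by (simp add: T_def)
  \<comment> \<open>Stage 0 is \<open>R\<close>, which separates \<open>a\<close> and
    \<open>b\<close>, so a single step joins them; the stage just before that step is the iterate in
    which they form a key witness pair.\<close>
  ultimately have "\<exists>i. \<not> T i a b \<and> T (Suc i) a b"
    by (induction n) blast+
  then obtain i where i: "\<not> T i a b" "T (Suc i) a b"
    by blast
  note C = between_cong[OF T]
  \<comment> \<open>If \<open>x\<close> were congruent to \<open>y + c\<close> at stage
    \<open>i\<close>, equal colon sets would make \<open>c\<close> congruent to 0, and
    \<open>x\<close> to \<open>y\<close>.\<close>
  have incomparable: "x \<notin> qideal (T i) y"
    if "\<not> T i x y" and xy: "colon_set P R w x = colon_set P R w y" for x y
  proof
    assume "x \<in> qideal (T i) y"
    then obtain c where c: "T i x (y + c)"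
      by (auto simp: qideal_def)
    have "\<not> nil_mod R y"
    proof
      assume y: "nil_mod R y"
      then have "nil_mod R x"
        using xy by (simp flip: colon_empty_iff)
      then show False
        using y that(1) nil_mod_iff[OF cong y] between_le[OF T] by blast
    qed
    moreover have "colon_set P R w (y + c) = colon_set P R w y"
      using between_colon[OF T c] xy by (rule trans[OF sym])
    ultimately have "R c 0"
      using colon_eq_add by blast
    then have "R (y + c) y"
      using congruence_add_left[OF cong, of c 0 y] by simp
    then show False
      using that(1) c between_le[OF T] congruence_trans[OF C] by blast
  qed
  have "\<not> T i b a"
    using i(1) congruence_sym[OF C] by blast
  moreover have "\<forall>p\<in>P. T i (a + p) (b + p)"
    using i by (simp add: T_Suc soccular_collapse_iff[OF T])
  ultimately have "key_witness_pair P (T i) a b"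
    using incomparable i(1) eq by (simp add: key_witness_pair_iff[OF C ideal_P nonempty])
  then show ?thesis
    by (auto simp: protected_witnesses_pair_def T_def)
qed

lemma protected_iff_colon_eq:
  assumes "\<not> R a b"
  shows "protected_witnesses_pair P R a b \<longleftrightarrow> colon_set P R w a = colon_set P R w b"
  using assms colon_eq_protected key_witness_pair_between_colon_eq[OF between_iterate]
  by (auto simp: protected_witnesses_pair_def)

end

theorem theorem3p14:
  fixes P :: "'q::comm_monoid_add set"
    and R :: "'q \<Rightarrow> 'q \<Rightarrow> bool"
    and w q q' :: 'q
  assumes "noetherian_monoid TYPE('q)"
    and "monoid_prime P"
    and "P \<noteq> {}"
    and "coprincipal_congruence P R"
    and "cogenerator P R w"
    and "\<not> R q q'"
  shows "protected_witnesses_pair P R q q' \<longleftrightarrow> colon_set P R w q = colon_set P R w q'"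
proof -
  interpret coprincipal P R w
    using assms(1-5) by unfold_locales
  show ?thesis
    using assms(6) by (rule protected_iff_colon_eq)
qed

end
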